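(* Let $(Y_n)_{n\in\mathbb N_0}$ be a Markov process with state space $E\subseteq\mathbb R$, let $0<\rho\le 1$, let $g:\mathbb R\to[0,\infty)$ satisfy $\{y:g(y)>0\}=\{y:y>b\}$ for some $b\in\mathbb R\cup\{-\infty\}$, and let $V$, $S^*$, $\tau_y$, $\phi$ be as defined in the context. Assume: (1) for every $y\in E$: $E_y\sup_n\rho^n g(Y_n)<\infty$ and $\rho^n g(Y_n)\to0$ $P_y$-a.s. as $n\to\infty$; (2) the optimal stopping set $S^*=\{y\in E:V(y)=g(y)\}$ is of the form $S^*=[a^*,\infty)$ or $S^*=(a^*,\infty)$ (intersected with $E$), where $a^*=\inf S^*\in\mathbb R$ and $a^*>b$; (3) for all $z,z'\in E$ with $z'>z>b$: $\phi(z)\le g(z)$ implies $\phi(z')\le g(z')$. Then $$a^*=\inf\{z\in E:\ z>b,\ \phi(z)\le g(z)\}.$$ Moreover, for $a^*\in E$: if $\phi(a^* )\le g(a^* )$, then $S^*=[a^*,\infty)$ (intersected with $E$); otherwise $S^*=(a^*,\infty)$ (intersected with $E$).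
   Context: Setting: $(Y_n)_{n\in\mathbb N_0}$ is a (time-homogeneous) Markov process with respect to a filtration $(\mathcal A_n)_{n\in\mathbb N_0}$, with state space $E\subseteq\mathbb R$; under $P_y$ it starts at $Y_0=y$, and $E_y$ is the corresponding expectation. $g$ is measurable. Stopping times may take the value $+\infty$; conventions: $Y_\infty=\Delta$ for an extra state $\Delta\notin\mathbb R$, $g(\Delta)=0$, $\rho^\infty=0$ (also when $\rho=1$), $\inf\emptyset=\infty$. Value function: $V(y)=\sup_\tau E_y\rho^\tau g(Y_\tau)$, the supremum being over all stopping times $\tau$ with respect to $(\mathcal A_n)$. Stopping set: $S^*=\{y\in E:V(y)=g(y)\}$. For $y\in E$: $\tau_y=\inf\{n>0:Y_n>y\}$ and $\phi(y)=E_y\rho^{\tau_y}g(Y_{\tau_y})$. *)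

theory Defs
  imports "HOL-Probability.Probability" "HOL-Library.Extended_Nat"
begin

text \<open>A time-homogeneous Markov process in the canonical notation with one family of probability
  measures \<open>P y\<close> (\<open>y \<in> E\<close>) on a common filtered measurable space. Only the \<open>\<sigma>\<close>-algebra of
  \<open>M\<close> matters, not its measure. \<open>E\<close> carries the trace of the Borel \<open>\<sigma>\<close>-algebra, and \<open>A\<close> may be
  larger than the filtration generated by \<open>Y\<close>.\<close>

locale markov_process = filtration "space M" A
  for E :: "real set"
    and M :: "'w measure"
    and A :: "nat \<Rightarrow> 'w measure"
    and Y :: "nat \<Rightarrow> 'w \<Rightarrow> real"
    and P :: "real \<Rightarrow> 'w measure" +
  assumes subalg: "\<And>n. subalgebra M (A n)"
    and adapted: "\<And>n. Y n \<in> A n \<rightarrow>\<^sub>M restrict_space borel E"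
    and prob: "\<And>y. y \<in> E \<Longrightarrow> prob_space (P y)"
    and sets_P: "\<And>y. y \<in> E \<Longrightarrow> sets (P y) = sets M"
    and start: "\<And>y. y \<in> E \<Longrightarrow> AE \<omega> in P y. Y 0 \<omega> = y"
    and kernel: "\<And>m B. B \<in> sets borel \<Longrightarrow>
      (\<lambda>y. measure (P y) {\<omega> \<in> space M. Y m \<omega> \<in> B}) \<in> borel_measurable (restrict_space borel E)"
    and markov: "\<And>y n m B. y \<in> E \<Longrightarrow> B \<in> sets borel \<Longrightarrow>
      AE \<omega> in P y.
        real_cond_exp (P y) (A n) (indicator {\<omega>' \<in> space M. Y (n + m) \<omega>' \<in> B}) \<omega> =
        measure (P (Y n \<omega>)) {\<omega>' \<in> space M. Y m \<omega>' \<in> B}"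

text \<open>The library's \<open>stopping_time\<close> requires the time to have the index type of the filtration;
  here times are indexed by \<open>nat\<close> but may be infinite.\<close>

definition enat_stopping_time :: "(nat \<Rightarrow> 'w measure) \<Rightarrow> ('w \<Rightarrow> enat) \<Rightarrow> bool" where
  "enat_stopping_time A \<tau> \<longleftrightarrow> (\<forall>n. Measurable.pred (A n) (\<lambda>\<omega>. \<tau> \<omega> \<le> enat n))"

text \<open>\<open>\<rho>\<^sup>\<tau> g(Y\<^sub>\<tau>)\<close>, where the value \<open>0\<close> on \<open>\<tau> = \<infinity>\<close> encodes
  \<open>\<rho>\<^sup>\<infinity> = 0\<close> and \<open>g(\<Delta>) = 0\<close>.\<close>

definition stopped_reward ::
    "real \<Rightarrow> (real \<Rightarrow> real) \<Rightarrow> (nat \<Rightarrow> 'w \<Rightarrow> real) \<Rightarrow> ('w \<Rightarrow> enat) \<Rightarrow> 'w \<Rightarrow> real" where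
  "stopped_reward \<rho> g Y \<tau> \<omega> = (case \<tau> \<omega> of enat n \<Rightarrow> \<rho> ^ n * g (Y n \<omega>) | \<infinity> \<Rightarrow> 0)"

text \<open>Rewards are nonnegative, so expectations are taken as \<open>ennreal\<close>-valued integrals.\<close>

definition expected_reward ::
    "(nat \<Rightarrow> 'w \<Rightarrow> real) \<Rightarrow> (real \<Rightarrow> 'w measure) \<Rightarrow> real \<Rightarrow> (real \<Rightarrow> real) \<Rightarrow>
     ('w \<Rightarrow> enat) \<Rightarrow> real \<Rightarrow> ennreal" where
  "expected_reward Y P \<rho> g \<tau> y = (\<integral>\<^sup>+\<omega>. ennreal (stopped_reward \<rho> g Y \<tau> \<omega>) \<partial>P y)"

definition value_function ::
    "(nat \<Rightarrow> 'w measure) \<Rightarrow> (nat \<Rightarrow> 'w \<Rightarrow> real) \<Rightarrow> (real \<Rightarrow> 'w measure) \<Rightarrow> real \<Rightarrow>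
     (real \<Rightarrow> real) \<Rightarrow> real \<Rightarrow> ennreal" where
  "value_function A Y P \<rho> g y =
     (SUP \<tau> \<in> {\<tau>. enat_stopping_time A \<tau>}. expected_reward Y P \<rho> g \<tau> y)"

definition stopping_set ::
    "real set \<Rightarrow> (nat \<Rightarrow> 'w measure) \<Rightarrow> (nat \<Rightarrow> 'w \<Rightarrow> real) \<Rightarrow> (real \<Rightarrow> 'w measure) \<Rightarrow>
     real \<Rightarrow> (real \<Rightarrow> real) \<Rightarrow> real set" where
  "stopping_set E A Y P \<rho> g = {y \<in> E. value_function A Y P \<rho> g y = ennreal (g y)}"

text \<open>The infimum is taken in \<open>enat\<close>, so it is \<open>\<infinity>\<close> if the level is never exceeded.\<close>

definition exceed_time :: "(nat \<Rightarrow> 'w \<Rightarrow> real) \<Rightarrow> real \<Rightarrow> 'w \<Rightarrow> enat" where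
  "exceed_time Y y \<omega> = Inf {enat n | n. n > 0 \<and> Y n \<omega> > y}"

definition ladder_reward ::
    "(nat \<Rightarrow> 'w \<Rightarrow> real) \<Rightarrow> (real \<Rightarrow> 'w measure) \<Rightarrow> real \<Rightarrow> (real \<Rightarrow> real) \<Rightarrow> real \<Rightarrow> ennreal" where
  "ladder_reward Y P \<rho> g y = expected_reward Y P \<rho> g (exceed_time Y y) y"

end

theory Submission
  imports Defs
begin

text \<open>Write \<open>T f x = \<rho> E\<^sub>x f(Y\<^sub>1)\<close>. The integrability and decay conditions make \<open>V\<close> the limit of
  the value iteration \<open>f \<mapsto> max g (T f)\<close> and also the limit of the rewards for stopping on entering
  \<open>S\<close> within finitely many steps. The theorem then amounts to
  \<open>S = {z \<in> E. z > b \<and> \<phi> z \<le> g z}\<close>. The inclusion \<open>\<subseteq>\<close> holds because \<open>\<tau>\<^sub>z\<close> is an admissible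
  stopping time. Conversely, let \<open>\<phi> z \<le> g z\<close> and \<open>z \<notin> S\<close>. The set \<open>S\<close> is an up-set in \<open>E\<close>, so it lies
  above \<open>z\<close> and is entered from \<open>z\<close> through a ladder time; as \<open>\<phi> \<le> g\<close> from \<open>z\<close> on, running
  through the successive ladder times never gains, which gives \<open>V z \<le> g z\<close>.\<close>

section \<open>The discounted transition operator and its measurability\<close>

locale discounted_markov_process = markov_process E M A Y P
  for E :: "real set" and M :: "'w measure" and A Y P +
  fixes \<rho> :: real and g :: "real \<Rightarrow> real"
  assumes \<rho>_nonneg: "0 \<le> \<rho>"
    and g_measurable [measurable]: "g \<in> borel_measurable borel"
    and g_nonneg: "\<And>y. 0 \<le> g y"
begin

abbreviation RE :: "real measure" where
  "RE \<equiv> restrict_space borel E"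

text \<open>The operator T of the overview. Values in \<open>ennreal\<close> make it total, so no
  integrability has to be carried along.\<close>

definition dstep :: "(real \<Rightarrow> ennreal) \<Rightarrow> real \<Rightarrow> ennreal" where
  "dstep f x = ennreal \<rho> * (\<integral>\<^sup>+\<omega>. f (Y 1 \<omega>) \<partial>P x)"

definition disc :: "nat \<Rightarrow> (real \<Rightarrow> ennreal) \<Rightarrow> 'w \<Rightarrow> ennreal" where
  "disc n f \<omega> = ennreal (\<rho> ^ n) * f (Y n \<omega>)"

lemma space_RE [simp]: "space RE = E"
  by (simp add: space_restrict_space)

lemma g_measurable_RE [measurable]: "(\<lambda>x. ennreal (g x)) \<in> borel_measurable RE"
  by (intro measurable_restrict_space1) measurable

lemma space_A [simp]: "space (A n) = space M"
  using subalg[of n] by (simp add: subalgebra_def)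

lemma space_P [simp]: "y \<in> E \<Longrightarrow> space (P y) = space M"
  using sets_P sets_eq_imp_space_eq by blast

lemma Y_in_E [simp]: "\<omega> \<in> space M \<Longrightarrow> Y n \<omega> \<in> E"
  using measurable_space[OF adapted, of \<omega> n] by simp

lemma subalgebra_P: "y \<in> E \<Longrightarrow> subalgebra (P y) (A n)"
  using subalg[of n] sets_P[of y] by (simp add: subalgebra_def)

lemma sets_A_P: "y \<in> E \<Longrightarrow> B \<in> sets (A n) \<Longrightarrow> B \<in> sets (P y)"
  using subalgebra_P[of y n] by (auto simp: subalgebra_def)

lemma sets_A_Suc: "B \<in> sets (A n) \<Longrightarrow> B \<in> sets (A (Suc n))"
  using sets_F_mono[of n "Suc n"] by auto

lemma measurable_Y_P [measurable]: "y \<in> E \<Longrightarrow> Y n \<in> P y \<rightarrow>\<^sub>M RE"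
  using measurable_from_subalg[OF subalgebra_P adapted] .

lemma g_Y_measurable [measurable]:
  "y \<in> E \<Longrightarrow> (\<lambda>\<omega>. ennreal (\<rho> ^ n * g (Y n \<omega>))) \<in> borel_measurable (P y)"
proof -
  assume y: "y \<in> E"
  have "Y n \<in> P y \<rightarrow>\<^sub>M borel"
    using measurable_Y_P[OF y] by (simp add: measurable_restrict_space2_iff)
  then show ?thesis
    by measurable
qed

lemma disc_measurable [measurable]:
  "y \<in> E \<Longrightarrow> f \<in> borel_measurable RE \<Longrightarrow> disc n f \<in> borel_measurable (P y)"
  using measurable_compose[OF measurable_Y_P, of y f borel n] unfolding disc_def by measurable

lemma disc_g: "disc n (\<lambda>x. ennreal (g x)) \<omega> = ennreal (\<rho> ^ n * g (Y n \<omega>))"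
  using \<rho>_nonneg g_nonneg by (simp add: disc_def ennreal_mult)

text \<open>The assumption \<open>kernel\<close> concerns probabilities of Borel sets only. It makes
  the laws of \<open>Y n\<close> a measurable map into \<open>subprob_algebra RE\<close>, and
  integrals against such a map are measurable in the starting point.\<close>

lemma transition_measurable [measurable]:
  assumes f: "f \<in> borel_measurable RE"
  shows "(\<lambda>x. \<integral>\<^sup>+\<omega>. f (Y n \<omega>) \<partial>P x) \<in> borel_measurable RE"
proof -
  let ?K = "\<lambda>x. distr (P x) RE (Y n)"
  have "?K \<in> RE \<rightarrow>\<^sub>M subprob_algebra RE"
  proof (rule measurable_subprob_algebra)
    fix x assume "x \<in> space RE"
    then have x: "x \<in> E" by simp
    interpret prob_space "P x" using prob[OF x] .
    show "subprob_space (?K x)"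
      using prob_space_distr[OF measurable_Y_P[OF x]] by (rule prob_space_imp_subprob_space)
    show "sets (?K x) = sets RE" by simp
  next
    fix C assume "C \<in> sets RE"
    then obtain B where B: "B \<in> sets borel" "C = B \<inter> E"
      by (auto simp: sets_restrict_space)
    have eq: "emeasure (?K x) C = ennreal (measure (P x) {\<omega> \<in> space M. Y n \<omega> \<in> B})"
      if x: "x \<in> E" for x
    proof -
      interpret prob_space "P x" using prob[OF x] .
      have "emeasure (?K x) C = emeasure (P x) (Y n -` C \<inter> space (P x))"
        using \<open>C \<in> sets RE\<close> measurable_Y_P[OF x] by (simp add: emeasure_distr)
      also have "Y n -` C \<inter> space (P x) = {\<omega> \<in> space M. Y n \<omega> \<in> B}"
        using B x by auto
      finally show ?thesis by (simp add: emeasure_eq_measure)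
    qed
    show "(\<lambda>x. emeasure (?K x) C) \<in> borel_measurable RE"
      using kernel[OF B(1), of n] by (subst measurable_cong[OF eq]) simp_all
  qed
  then have "(\<lambda>x. \<integral>\<^sup>+z. f z \<partial>?K x) \<in> borel_measurable RE"
    using measurable_compose[OF _ nn_integral_measurable_subprob_algebra[OF f]] by blast
  then show ?thesis
    using f by (subst measurable_cong[where g="\<lambda>x. \<integral>\<^sup>+z. f z \<partial>?K x"]) 
      (simp_all add: nn_integral_distr[OF measurable_Y_P])
qed

lemma dstep_measurable [measurable]:
  "f \<in> borel_measurable RE \<Longrightarrow> dstep f \<in> borel_measurable RE"
  unfolding dstep_def by measurable

lemma dstep_mono:
  "x \<in> E \<Longrightarrow> (\<And>y. y \<in> E \<Longrightarrow> f y \<le> h y) \<Longrightarrow> dstep f x \<le> dstep h x"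
  unfolding dstep_def by (intro mult_left_mono nn_integral_mono) auto

lemma dstep_add:
  assumes "x \<in> E" "f \<in> borel_measurable RE" "h \<in> borel_measurable RE"
  shows "dstep (\<lambda>y. f y + h y) x = dstep f x + dstep h x"
  using assms unfolding dstep_def by (subst nn_integral_add) (auto simp: distrib_left)

lemma dstep_eq_disc: "x \<in> E \<Longrightarrow> f \<in> borel_measurable RE \<Longrightarrow> dstep f x = (\<integral>\<^sup>+\<omega>. disc 1 f \<omega> \<partial>P x)"
  unfolding dstep_def disc_def by (subst nn_integral_cmult) auto

lemma nn_integral_start:
  assumes y: "y \<in> E" shows "(\<integral>\<^sup>+\<omega>. f (Y 0 \<omega>) \<partial>P y) = f y"
proof -
  interpret prob_space "P y" using prob[OF y] .
  have "(\<integral>\<^sup>+\<omega>. f (Y 0 \<omega>) \<partial>P y) = (\<integral>\<^sup>+\<omega>. f y \<partial>P y)"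
    using start[OF y] by (intro nn_integral_cong_AE) auto
  then show ?thesis by (simp add: emeasure_space_1)
qed

lemma nn_integral_disc_0: "y \<in> E \<Longrightarrow> (\<integral>\<^sup>+\<omega>. disc 0 f \<omega> \<partial>P y) = f y"
  by (simp add: disc_def nn_integral_start)

section \<open>The Markov property for integrals of nonnegative functions\<close>

text \<open>This is \<open>markov\<close> for one step, integrated over \<open>B\<close>. Keeping an
  arbitrary event \<open>B\<close> of \<open>A n\<close> is what later allows arguments restricted
  to paths that have not yet stopped.\<close>

lemma markov_indicator:
  assumes y: "y \<in> E" and B: "B \<in> sets (A n)" and C: "C \<in> sets RE"
  shows "(\<integral>\<^sup>+\<omega>\<in>B. indicator C (Y (Suc n) \<omega>) \<partial>P y) =
         (\<integral>\<^sup>+\<omega>\<in>B. (\<integral>\<^sup>+\<omega>'. indicator C (Y 1 \<omega>') \<partial>P (Y n \<omega>)) \<partial>P y)"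
proof -
  interpret prob_space "P y" using prob[OF y] .
  interpret sub: finite_measure_subalgebra "P y" "A n"
    by unfold_locales (rule subalgebra_P[OF y])
  \<comment> \<open>\<open>markov\<close> speaks of Borel sets of reals, while \<open>C\<close> lies
    in the trace on \<open>E\<close>. As \<open>Y\<close> takes values in \<open>E\<close>, both
    sets describe the same event.\<close>
  obtain D where D: "D \<in> sets borel" "C = D \<inter> E"
    using C by (auto simp: sets_restrict_space)
  let ?U = "{\<omega> \<in> space M. Y (Suc n) \<omega> \<in> D}"
  let ?q = "\<lambda>\<omega>. measure (P (Y n \<omega>)) {\<omega>' \<in> space M. Y 1 \<omega>' \<in> D}"
  have BP [measurable]: "B \<in> sets (P y)" using sets_A_P[OF y B] .
  have U: "?U \<in> sets (P y)"
  proof -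
    have "Y (Suc n) -` C \<inter> space (P y) \<in> sets (P y)"
      using measurable_Y_P[OF y] C by (rule measurable_sets)
    also have "Y (Suc n) -` C \<inter> space (P y) = ?U" using y D by auto
    finally show ?thesis .
  qed
  have q_meas: "?q \<in> borel_measurable (P y)"
    using measurable_compose[OF measurable_Y_P[OF y, of n] kernel[OF D(1), of 1]] by simp
  have q_int: "integrable (P y) ?q"
  proof (rule integrable_const_bound[where B=1])
    show "AE \<omega> in P y. norm (?q \<omega>) \<le> 1"
      using y by (intro AE_I2) (auto intro!: prob_space.prob_le_1 prob)
  qed (rule q_meas)
  \<comment> \<open>The nonnegative integral passes to a Bochner integral, where
    \<open>real_cond_exp\<close> can be replaced on \<open>B\<close>, and afterwards back.\<close>
  have "(\<integral>\<^sup>+\<omega>\<in>B. indicator C (Y (Suc n) \<omega>) \<partial>P y) = (\<integral>\<^sup>+\<omega>. ennreal (indicator B \<omega> * indicator ?U \<omega>) \<partial>P y)"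
    using y D by (intro nn_integral_cong) (auto simp: indicator_def)
  also have "\<dots> = ennreal (\<integral>\<omega>. indicator B \<omega> * indicator ?U \<omega> \<partial>P y)"
    using U by (intro nn_integral_eq_integral)
      (auto simp: mult.commute[of "indicator B _"] less_top[symmetric]
        intro!: integrable_real_mult_indicator)
  also have "(\<integral>\<omega>. indicator B \<omega> * indicator ?U \<omega> \<partial>P y) =
      (\<integral>\<omega>. indicator B \<omega> * real_cond_exp (P y) (A n) (indicator ?U) \<omega> \<partial>P y)"
    using sub.real_cond_exp_intA[of "indicator ?U" B] U B
    by (simp add: set_lebesgue_integral_def less_top[symmetric])
  also have "\<dots> = (\<integral>\<omega>. indicator B \<omega> * ?q \<omega> \<partial>P y)"
    using markov[OF y D(1), of n 1] q_meas by (intro integral_cong_AE) auto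
  also have "ennreal \<dots> = (\<integral>\<^sup>+\<omega>. ennreal (indicator B \<omega> * ?q \<omega>) \<partial>P y)"
    using q_int by (intro nn_integral_eq_integral[symmetric])
      (auto simp: mult.commute[of "indicator B _"] intro!: integrable_real_mult_indicator)
  also have "\<dots> = (\<integral>\<^sup>+\<omega>\<in>B. (\<integral>\<^sup>+\<omega>'. indicator C (Y 1 \<omega>') \<partial>P (Y n \<omega>)) \<partial>P y)"
  proof (rule nn_integral_cong)
    fix \<omega> assume "\<omega> \<in> space (P y)"
    then have x: "Y n \<omega> \<in> E" using y by simp
    interpret x: prob_space "P (Y n \<omega>)" using prob[OF x] .
    have eq: "Y 1 -` C \<inter> space (P (Y n \<omega>)) = {\<omega>' \<in> space M. Y 1 \<omega>' \<in> D}"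
      using x D by auto
    have "(\<integral>\<^sup>+\<omega>'. indicator C (Y 1 \<omega>') \<partial>P (Y n \<omega>)) =
        (\<integral>\<^sup>+\<omega>'. indicator (Y 1 -` C \<inter> space (P (Y n \<omega>))) \<omega>' \<partial>P (Y n \<omega>))"
      by (intro nn_integral_cong) (auto simp: indicator_def)
    also have "\<dots> = ennreal (?q \<omega>)"
      using measurable_sets[OF measurable_Y_P[OF x, of 1] C]
      unfolding eq by (simp add: x.emeasure_eq_measure)
    finally show "ennreal (indicator B \<omega> * ?q \<omega>) =
        (\<integral>\<^sup>+\<omega>'. indicator C (Y 1 \<omega>') \<partial>P (Y n \<omega>)) * indicator B \<omega>"
      by (simp add: indicator_def)
  qed
  finally show ?thesis .
qed

text \<open>The standard extension from indicators: both sides are linear in \<open>f\<close> and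
  continuous along increasing sequences.\<close>

lemma markov_nn_integral:
  assumes y: "y \<in> E" and B: "B \<in> sets (A n)" and f: "f \<in> borel_measurable RE"
  shows "(\<integral>\<^sup>+\<omega>\<in>B. f (Y (Suc n) \<omega>) \<partial>P y) =
         (\<integral>\<^sup>+\<omega>\<in>B. (\<integral>\<^sup>+\<omega>'. f (Y 1 \<omega>') \<partial>P (Y n \<omega>)) \<partial>P y)"
  using f
proof (induction rule: borel_measurable_induct)
  case (cong f h)
  have "(\<integral>\<^sup>+\<omega>\<in>B. f (Y (Suc n) \<omega>) \<partial>P y) = (\<integral>\<^sup>+\<omega>\<in>B. h (Y (Suc n) \<omega>) \<partial>P y)"
    using cong(3) y by (intro nn_integral_cong) auto
  moreover have "(\<integral>\<^sup>+\<omega>\<in>B. (\<integral>\<^sup>+\<omega>'. f (Y 1 \<omega>') \<partial>P (Y n \<omega>)) \<partial>P y) =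
      (\<integral>\<^sup>+\<omega>\<in>B. (\<integral>\<^sup>+\<omega>'. h (Y 1 \<omega>') \<partial>P (Y n \<omega>)) \<partial>P y)"
    using cong(3) y by (intro nn_integral_cong arg_cong2[where f="(*)"]) auto
  ultimately show ?case using cong(4) by simp
next
  case (set C)
  then show ?case by (rule markov_indicator[OF y B])
next
  case (mult u c)
  note [measurable] = mult(2) sets_A_P[OF y B]
  have "(\<integral>\<^sup>+\<omega>\<in>B. (c * u (Y (Suc n) \<omega>)) \<partial>P y) = c * (\<integral>\<^sup>+\<omega>\<in>B. u (Y (Suc n) \<omega>) \<partial>P y)"
    using y by (simp add: mult.assoc nn_integral_cmult)
  also have "\<dots> = (\<integral>\<^sup>+\<omega>. c * ((\<integral>\<^sup>+\<omega>'. u (Y 1 \<omega>') \<partial>P (Y n \<omega>)) * indicator B \<omega>) \<partial>P y)"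
    unfolding mult.IH using y by (subst nn_integral_cmult) auto
  also have "\<dots> = (\<integral>\<^sup>+\<omega>\<in>B. (\<integral>\<^sup>+\<omega>'. c * u (Y 1 \<omega>') \<partial>P (Y n \<omega>)) \<partial>P y)"
    using y by (intro nn_integral_cong) (auto simp: nn_integral_cmult mult.assoc)
  finally show ?case .
next
  case (add u v)
  note [measurable] = add.hyps(1,3) sets_A_P[OF y B]
  have "(\<integral>\<^sup>+\<omega>\<in>B. (v (Y (Suc n) \<omega>) + u (Y (Suc n) \<omega>)) \<partial>P y) =
      (\<integral>\<^sup>+\<omega>\<in>B. v (Y (Suc n) \<omega>) \<partial>P y) + (\<integral>\<^sup>+\<omega>\<in>B. u (Y (Suc n) \<omega>) \<partial>P y)"
    using y by (simp add: distrib_right nn_integral_add)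
  also have "\<dots> = (\<integral>\<^sup>+\<omega>. (\<integral>\<^sup>+\<omega>'. v (Y 1 \<omega>') \<partial>P (Y n \<omega>)) * indicator B \<omega> +
      (\<integral>\<^sup>+\<omega>'. u (Y 1 \<omega>') \<partial>P (Y n \<omega>)) * indicator B \<omega> \<partial>P y)"
    unfolding add.IH using y by (subst nn_integral_add) auto
  also have "\<dots> = (\<integral>\<^sup>+\<omega>\<in>B. (\<integral>\<^sup>+\<omega>'. v (Y 1 \<omega>') + u (Y 1 \<omega>') \<partial>P (Y n \<omega>)) \<partial>P y)"
    using y by (intro nn_integral_cong) (auto simp: nn_integral_add distrib_right)
  finally show ?case .
next
  case (seq U)
  note [measurable] = seq(1) sets_A_P[OF y B]
  have "(\<integral>\<^sup>+\<omega>\<in>B. (SUP i. U i) (Y (Suc n) \<omega>) \<partial>P y) =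
      (SUP i. \<integral>\<^sup>+\<omega>\<in>B. U i (Y (Suc n) \<omega>) \<partial>P y)"
    using y seq(3) by (subst nn_integral_monotone_convergence_SUP[symmetric])
      (auto simp: SUP_mult_right_ennreal incseq_def le_fun_def image_comp intro!: mult_right_mono)
  also have "\<dots> = (\<integral>\<^sup>+\<omega>. (SUP i. (\<integral>\<^sup>+\<omega>'. U i (Y 1 \<omega>') \<partial>P (Y n \<omega>)) * indicator B \<omega>) \<partial>P y)"
    unfolding seq.IH using y seq(3) by (subst nn_integral_monotone_convergence_SUP)
      (auto simp: incseq_def le_fun_def intro!: mult_right_mono nn_integral_mono)
  also have "\<dots> = (\<integral>\<^sup>+\<omega>\<in>B. (\<integral>\<^sup>+\<omega>'. (SUP i. U i) (Y 1 \<omega>') \<partial>P (Y n \<omega>)) \<partial>P y)"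
  proof (rule nn_integral_cong)
    fix \<omega> assume "\<omega> \<in> space (P y)"
    then have x: "Y n \<omega> \<in> E" using y by simp
    have "(\<integral>\<^sup>+\<omega>'. (SUP i. U i (Y 1 \<omega>')) \<partial>P (Y n \<omega>)) = (SUP i. \<integral>\<^sup>+\<omega>'. U i (Y 1 \<omega>') \<partial>P (Y n \<omega>))"
      using x seq(3) by (intro nn_integral_monotone_convergence_SUP) (auto simp: incseq_def le_fun_def)
    then show "(SUP i. (\<integral>\<^sup>+\<omega>'. U i (Y 1 \<omega>') \<partial>P (Y n \<omega>)) * indicator B \<omega>) =
        (\<integral>\<^sup>+\<omega>'. (SUP i. U i) (Y 1 \<omega>') \<partial>P (Y n \<omega>)) * indicator B \<omega>"
      by (simp add: SUP_mult_right_ennreal image_comp)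
  qed
  finally show ?case by simp
qed

text \<open>The form in which the Markov property is used below: on an event known at time
  \<open>n\<close>, one unit of time is traded for one application of \<open>dstep\<close>.\<close>

lemma markov_disc:
  assumes y: "y \<in> E" and B: "B \<in> sets (A n)" and f: "f \<in> borel_measurable RE"
  shows "(\<integral>\<^sup>+\<omega>\<in>B. disc (Suc n) f \<omega> \<partial>P y) = (\<integral>\<^sup>+\<omega>\<in>B. disc n (dstep f) \<omega> \<partial>P y)"
proof -
  note [measurable] = f sets_A_P[OF y B]
  have "(\<integral>\<^sup>+\<omega>\<in>B. disc (Suc n) f \<omega> \<partial>P y) = ennreal (\<rho> ^ Suc n) * (\<integral>\<^sup>+\<omega>\<in>B. f (Y (Suc n) \<omega>) \<partial>P y)"
    using y by (simp add: disc_def mult.assoc nn_integral_cmult)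
  also have "\<dots> = (\<integral>\<^sup>+\<omega>. ennreal (\<rho> ^ Suc n) * ((\<integral>\<^sup>+\<omega>'. f (Y 1 \<omega>') \<partial>P (Y n \<omega>)) * indicator B \<omega>) \<partial>P y)"
    unfolding markov_nn_integral[OF y B f] using y by (subst nn_integral_cmult) auto
  also have "\<dots> = (\<integral>\<^sup>+\<omega>\<in>B. disc n (dstep f) \<omega> \<partial>P y)"
    using \<rho>_nonneg by (simp add: disc_def dstep_def ennreal_mult mult_ac)
  finally show ?thesis .
qed

section \<open>Value iteration, tail suprema and entry rewards\<close>

text \<open>Finite-horizon values. Starting from 0 makes the sequence increasing, and its next
  member is already \<open>g\<close>.\<close>

primrec snell :: "nat \<Rightarrow> real \<Rightarrow> ennreal" where
  "snell 0 = (\<lambda>x. 0)"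
| "snell (Suc m) = (\<lambda>x. max (ennreal (g x)) (dstep (snell m) x))"

definition snell_lim :: "real \<Rightarrow> ennreal" where
  "snell_lim x = (SUP m. snell m x)"

text \<open>The best reward obtainable in hindsight from time \<open>n\<close> on; it bounds what is
  lost when the horizon is cut at \<open>n\<close>.\<close>

definition tail_sup :: "nat \<Rightarrow> 'w \<Rightarrow> ennreal" where
  "tail_sup n \<omega> = (SUP k\<in>{n..}. ennreal (\<rho> ^ k * g (Y k \<omega>)))"

text \<open>The expected reward for entering \<open>D\<close> within the first \<open>m\<close>
  observations, the starting point included, and 0 if this fails. \<open>hit_reward\<close> is its
  pathwise counterpart, with observations beginning at time \<open>n\<close> and discounting from
  time 0.\<close>

primrec hit_value :: "real set \<Rightarrow> nat \<Rightarrow> real \<Rightarrow> ennreal" where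
  "hit_value D 0 = (\<lambda>x. 0)"
| "hit_value D (Suc m) = (\<lambda>x. if x \<in> D then ennreal (g x) else dstep (hit_value D m) x)"

primrec hit_reward :: "real set \<Rightarrow> nat \<Rightarrow> nat \<Rightarrow> 'w \<Rightarrow> ennreal" where
  "hit_reward D 0 = (\<lambda>n \<omega>. 0)"
| "hit_reward D (Suc m) = (\<lambda>n \<omega>.
    if Y n \<omega> \<in> D then ennreal (\<rho> ^ n * g (Y n \<omega>)) else hit_reward D m (Suc n) \<omega>)"

definition hitting_time :: "real set \<Rightarrow> nat \<Rightarrow> 'w \<Rightarrow> enat" where
  "hitting_time D n \<omega> = Inf {enat k |k. n \<le> k \<and> Y k \<omega> \<in> D}"

lemma nn_integral_split:
  assumes "f \<in> borel_measurable N" "B \<in> sets N" "C \<in> sets N"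
  shows "(\<integral>\<^sup>+\<omega>\<in>B. f \<omega> \<partial>N) = (\<integral>\<^sup>+\<omega>\<in>B \<inter> C. f \<omega> \<partial>N) + (\<integral>\<^sup>+\<omega>\<in>B - C. f \<omega> \<partial>N)"
  using assms by (subst nn_integral_add[symmetric]) (auto intro!: nn_integral_cong simp: indicator_def)

lemma Y_vimage_A: "D \<in> sets RE \<Longrightarrow> {\<omega> \<in> space M. Y n \<omega> \<in> D} \<in> sets (A n)"
  using measurable_sets[OF adapted, of D n] by (simp add: vimage_def Int_def conj_commute)

section \<open>The fixed point equation for the limit of value iteration\<close>

lemma snell_measurable [measurable]: "snell m \<in> borel_measurable RE"
  by (induction m) auto

lemma snell_lim_measurable [measurable]: "snell_lim \<in> borel_measurable RE"
  unfolding snell_lim_def by measurable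

lemma snell_Suc_le: "x \<in> E \<Longrightarrow> snell m x \<le> snell (Suc m) x"
proof (induction m arbitrary: x)
  case (Suc m)
  have "dstep (snell m) x \<le> dstep (snell (Suc m)) x"
    by (rule dstep_mono[OF Suc.prems Suc.IH])
  then show ?case
    by (simp add: max.coboundedI2)
qed simp

lemma incseq_snell: "x \<in> E \<Longrightarrow> incseq (\<lambda>m. snell m x)"
  using snell_Suc_le by (rule incseq_SucI)

lemma dstep_SUP:
  assumes "x \<in> E" "\<And>m. f m \<in> borel_measurable RE" "\<And>y. y \<in> E \<Longrightarrow> incseq (\<lambda>m. f m y)"
  shows "dstep (\<lambda>y. SUP m. f m y) x = (SUP m. dstep (f m) x)"
proof -
  have "f m (Y 1 \<omega>) \<le> f (Suc m) (Y 1 \<omega>)" if "\<omega> \<in> space M" for m \<omega>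
    using incseq_SucD[OF assms(3)] that by simp
  then have "(\<integral>\<^sup>+\<omega>. (SUP m. f m (Y 1 \<omega>)) \<partial>P x) = (SUP m. \<integral>\<^sup>+\<omega>. f m (Y 1 \<omega>) \<partial>P x)"
    using assms(1,2)
    by (intro nn_integral_monotone_convergence_SUP_AE)
      (auto intro!: AE_I2 measurable_compose[OF measurable_Y_P])
  then show ?thesis
    by (simp add: dstep_def SUP_mult_left_ennreal)
qed

text \<open>The Bellman equation. The recursion passes to the limit because the maximum with
  \<open>g\<close> and, by monotone convergence, \<open>dstep\<close> commute with increasing
  suprema.\<close>

lemma snell_lim_eq:
  assumes x: "x \<in> E"
  shows "snell_lim x = max (ennreal (g x)) (dstep snell_lim x)"
proof -
  have "snell_lim x = (SUP m. snell (Suc m) x)"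
    unfolding snell_lim_def
    by (intro antisym SUP_least) (auto intro: SUP_upper2 snell_Suc_le[OF x] simp del: snell.simps)
  also have "\<dots> = sup (ennreal (g x)) (SUP m. dstep (snell m) x)"
    by (simp add: SUP_sup_distrib[symmetric] sup_max[symmetric])
  also have "(SUP m. dstep (snell m) x) = dstep snell_lim x"
    unfolding snell_lim_def[abs_def]
    by (rule dstep_SUP[symmetric, OF x snell_measurable incseq_snell])
  finally show ?thesis by (simp add: sup_max)
qed

section \<open>Tail suprema as bounds for the remaining value\<close>

lemma tail_sup_measurable [measurable]: "y \<in> E \<Longrightarrow> tail_sup n \<in> borel_measurable (P y)"
  unfolding tail_sup_def by (intro borel_measurable_SUP) auto

lemma tail_sup_Suc_le: "tail_sup (Suc n) \<omega> \<le> tail_sup n \<omega>"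
  unfolding tail_sup_def by (intro SUP_subset_mono) auto

text \<open>An optimal finite-horizon strategy either stops at \<open>n\<close>, with a reward
  counted in \<open>tail_sup n\<close>, or continues. In the second case the induction hypothesis is
  needed at time \<open>Suc n\<close> on a smaller event, hence the generality in \<open>n\<close>
  and \<open>B\<close>.\<close>

lemma snell_le_tail_sup:
  assumes y: "y \<in> E" and B: "B \<in> sets (A n)"
  shows "(\<integral>\<^sup>+\<omega>\<in>B. disc n (snell m) \<omega> \<partial>P y) \<le> (\<integral>\<^sup>+\<omega>\<in>B. tail_sup n \<omega> \<partial>P y)"
  using B
proof (induction m arbitrary: n B)
  case 0
  then show ?case by (simp add: disc_def)
next
  case (Suc m)
  \<comment> \<open>The event on which the maximum in \<open>snell (Suc m)\<close> is attained by
    stopping at time \<open>n\<close>.\<close>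
  define C where "C = {\<omega> \<in> space M. Y n \<omega> \<in> {x \<in> space RE. dstep (snell m) x \<le> ennreal (g x)}}"
  have C: "C \<in> sets (A n)"
    unfolding C_def by (rule Y_vimage_A) measurable
  note sets = sets_A_P[OF y Suc.prems] sets_A_P[OF y C]
  have BC: "B - C \<in> sets (A n)" using Suc.prems C by auto
  have "(\<integral>\<^sup>+\<omega>\<in>B - C. disc n (snell (Suc m)) \<omega> \<partial>P y) = (\<integral>\<^sup>+\<omega>\<in>B - C. disc n (dstep (snell m)) \<omega> \<partial>P y)"
    using y by (intro nn_integral_cong) (auto simp: disc_def C_def indicator_def max_def)
  also have "\<dots> = (\<integral>\<^sup>+\<omega>\<in>B - C. disc (Suc n) (snell m) \<omega> \<partial>P y)"
    by (rule markov_disc[symmetric, OF y BC]) measurable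
  also have "\<dots> \<le> (\<integral>\<^sup>+\<omega>\<in>B - C. tail_sup (Suc n) \<omega> \<partial>P y)"
    by (rule Suc.IH[OF sets_A_Suc[OF BC]])
  also have "\<dots> \<le> (\<integral>\<^sup>+\<omega>\<in>B - C. tail_sup n \<omega> \<partial>P y)"
    by (intro nn_integral_mono mult_right_mono tail_sup_Suc_le) simp
  finally have 1: "(\<integral>\<^sup>+\<omega>\<in>B - C. disc n (snell (Suc m)) \<omega> \<partial>P y) \<le> (\<integral>\<^sup>+\<omega>\<in>B - C. tail_sup n \<omega> \<partial>P y)" .
  have 2: "(\<integral>\<^sup>+\<omega>\<in>B \<inter> C. disc n (snell (Suc m)) \<omega> \<partial>P y) \<le> (\<integral>\<^sup>+\<omega>\<in>B \<inter> C. tail_sup n \<omega> \<partial>P y)"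
  proof (intro nn_integral_mono)
    fix \<omega>
    have "disc n (snell (Suc m)) \<omega> = disc n (\<lambda>x. ennreal (g x)) \<omega>" if "\<omega> \<in> C"
      using that by (auto simp: disc_def C_def max_def)
    moreover have "disc n (\<lambda>x. ennreal (g x)) \<omega> \<le> tail_sup n \<omega>"
      unfolding disc_g tail_sup_def by (rule SUP_upper) simp
    ultimately show "disc n (snell (Suc m)) \<omega> * indicator (B \<inter> C) \<omega> \<le> tail_sup n \<omega> * indicator (B \<inter> C) \<omega>"
      by (auto simp: indicator_def)
  qed
  show ?case
    using add_mono[OF 2 1] sets y
    by (simp add: nn_integral_split[of "disc n (snell (Suc m))" "P y" B C]
        nn_integral_split[of "tail_sup n" "P y" B C] del: snell.simps)
qed

lemma snell_lim_le_tail_sup: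
  assumes y: "y \<in> E"
  shows "(\<integral>\<^sup>+\<omega>. disc n snell_lim \<omega> \<partial>P y) \<le> (\<integral>\<^sup>+\<omega>. tail_sup n \<omega> \<partial>P y)"
proof -
  have "(\<integral>\<^sup>+\<omega>. disc n snell_lim \<omega> \<partial>P y) = (\<integral>\<^sup>+\<omega>. (SUP m. disc n (snell m) \<omega>) \<partial>P y)"
    by (simp add: disc_def snell_lim_def SUP_mult_left_ennreal)
  also have "\<dots> = (SUP m. \<integral>\<^sup>+\<omega>. disc n (snell m) \<omega> \<partial>P y)"
    using y by (intro nn_integral_monotone_convergence_SUP_AE)
      (auto intro!: AE_I2 mult_left_mono snell_Suc_le simp: disc_def simp del: snell.simps)
  also have "\<dots> \<le> (\<integral>\<^sup>+\<omega>. tail_sup n \<omega> \<partial>P y)"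
  proof (rule SUP_least)
    fix m
    have "(\<integral>\<^sup>+\<omega>\<in>space M. disc n (snell m) \<omega> \<partial>P y) \<le> (\<integral>\<^sup>+\<omega>\<in>space M. tail_sup n \<omega> \<partial>P y)"
      using sets.top[of "A n"] by (intro snell_le_tail_sup[OF y]) simp
    then show "(\<integral>\<^sup>+\<omega>. disc n (snell m) \<omega> \<partial>P y) \<le> (\<integral>\<^sup>+\<omega>. tail_sup n \<omega> \<partial>P y)"
      using nn_set_integral_space[of "P y"] y by simp
  qed
  finally show ?thesis .
qed

text \<open>Dominated convergence with majorant \<open>tail_sup 0\<close>. Pathwise the tail suprema
  decrease to the limsup of the rewards, which is 0 wherever the rewards tend to 0.\<close>

lemma tail_sup_integral_tendsto_0:
  assumes y: "y \<in> E"
    and fin: "(\<integral>\<^sup>+\<omega>. (SUP n. ennreal (\<rho> ^ n * g (Y n \<omega>))) \<partial>P y) < \<infinity>"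
    and lim: "AE \<omega> in P y. (\<lambda>n. \<rho> ^ n * g (Y n \<omega>)) \<longlonglongrightarrow> 0"
  shows "(\<lambda>n. \<integral>\<^sup>+\<omega>. tail_sup n \<omega> \<partial>P y) \<longlonglongrightarrow> 0"
proof -
  have "(\<lambda>n. \<integral>\<^sup>+\<omega>. tail_sup n \<omega> \<partial>P y) \<longlonglongrightarrow> (\<integral>\<^sup>+\<omega>. 0 \<partial>P y)"
  proof (rule nn_integral_dominated_convergence[where w="tail_sup 0"])
    show "AE \<omega> in P y. tail_sup j \<omega> \<le> tail_sup 0 \<omega>" for j
      unfolding tail_sup_def by (intro AE_I2 SUP_subset_mono) auto
    show "(\<integral>\<^sup>+\<omega>. tail_sup 0 \<omega> \<partial>P y) < \<infinity>"
      using fin by (simp add: tail_sup_def)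
    show "AE \<omega> in P y. (\<lambda>n. tail_sup n \<omega>) \<longlonglongrightarrow> 0"
      using lim
    proof eventually_elim
      case (elim \<omega>)
      have "(\<lambda>n. ennreal (\<rho> ^ n * g (Y n \<omega>))) \<longlonglongrightarrow> 0"
        using tendsto_ennrealI[OF elim] by simp
      then have "limsup (\<lambda>n. ennreal (\<rho> ^ n * g (Y n \<omega>))) = 0"
        by (intro lim_imp_Limsup) auto
      then have "(INF n. tail_sup n \<omega>) = 0"
        by (simp add: limsup_INF_SUP tail_sup_def)
      moreover have "(\<lambda>n. tail_sup n \<omega>) \<longlonglongrightarrow> (INF n. tail_sup n \<omega>)"
        by (intro LIMSEQ_INF decseq_SucI tail_sup_Suc_le)
      ultimately show ?case by simp
    qed
  qed (use y in auto)
  then show ?thesis by simp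
qed

section \<open>Rewards for entering a set\<close>

lemma hit_value_measurable [measurable]:
  assumes [measurable]: "Measurable.pred RE (\<lambda>x. x \<in> D)"
  shows "hit_value D m \<in> borel_measurable RE"
  by (induction m) auto

lemma hit_reward_measurable:
  assumes [measurable]: "Measurable.pred RE (\<lambda>x. x \<in> D)" and y: "y \<in> E"
  shows "hit_reward D m n \<in> borel_measurable (P y)"
proof (induction m arbitrary: n)
  case (Suc m)
  have "Measurable.pred (P y) (\<lambda>\<omega>. Y n \<omega> \<in> D)"
    using measurable_compose[OF measurable_Y_P[OF y] assms(1)] .
  then show ?case using Suc y by (auto intro!: measurable_If)
qed simp

text \<open>The recursion in space and the recursion along paths agree on average: split at whether
  \<open>Y n\<close> lies in \<open>D\<close>, and use \<open>markov_disc\<close> where it does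
  not.\<close>

lemma hit_value_eq_hit_reward:
  assumes D: "Measurable.pred RE (\<lambda>x. x \<in> D)" and y: "y \<in> E" and B: "B \<in> sets (A n)"
  shows "(\<integral>\<^sup>+\<omega>\<in>B. disc n (hit_value D m) \<omega> \<partial>P y) = (\<integral>\<^sup>+\<omega>\<in>B. hit_reward D m n \<omega> \<partial>P y)"
  using B
proof (induction m arbitrary: n B)
  case 0
  then show ?case by (simp add: disc_def)
next
  case (Suc m)
  define C where "C = {\<omega> \<in> space M. Y n \<omega> \<in> {x \<in> space RE. x \<in> D}}"
  have C: "C \<in> sets (A n)"
    unfolding C_def using D by (intro Y_vimage_A) measurable
  note sets = sets_A_P[OF y Suc.prems] sets_A_P[OF y C]
  have BC: "B - C \<in> sets (A n)" using Suc.prems C by auto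
  have "(\<integral>\<^sup>+\<omega>\<in>B - C. disc n (hit_value D (Suc m)) \<omega> \<partial>P y) = (\<integral>\<^sup>+\<omega>\<in>B - C. disc n (dstep (hit_value D m)) \<omega> \<partial>P y)"
    using y by (intro nn_integral_cong) (auto simp: disc_def C_def indicator_def)
  also have "\<dots> = (\<integral>\<^sup>+\<omega>\<in>B - C. disc (Suc n) (hit_value D m) \<omega> \<partial>P y)"
    by (rule markov_disc[symmetric, OF y BC hit_value_measurable[OF D]])
  also have "\<dots> = (\<integral>\<^sup>+\<omega>\<in>B - C. hit_reward D m (Suc n) \<omega> \<partial>P y)"
    by (rule Suc.IH[OF sets_A_Suc[OF BC]])
  also have "\<dots> = (\<integral>\<^sup>+\<omega>\<in>B - C. hit_reward D (Suc m) n \<omega> \<partial>P y)"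
    using y by (intro nn_integral_cong) (auto simp: C_def indicator_def)
  finally have 1: "(\<integral>\<^sup>+\<omega>\<in>B - C. disc n (hit_value D (Suc m)) \<omega> \<partial>P y) = (\<integral>\<^sup>+\<omega>\<in>B - C. hit_reward D (Suc m) n \<omega> \<partial>P y)" .
  have 2: "(\<integral>\<^sup>+\<omega>\<in>B \<inter> C. disc n (hit_value D (Suc m)) \<omega> \<partial>P y) = (\<integral>\<^sup>+\<omega>\<in>B \<inter> C. hit_reward D (Suc m) n \<omega> \<partial>P y)"
    using y disc_g by (intro nn_integral_cong) (auto simp: C_def indicator_def disc_def)
  show ?case
    using 1 2 sets y hit_value_measurable[OF D, of "Suc m"] hit_reward_measurable[OF D y, of "Suc m" n]
    by (simp add: nn_integral_split[of _ "P y" B C] del: hit_value.simps hit_reward.simps)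
qed

lemma hitting_time_eq: "Y n \<omega> \<in> D \<Longrightarrow> hitting_time D n \<omega> = enat n"
  unfolding hitting_time_def by (intro antisym Inf_lower Inf_greatest) auto

lemma hitting_time_Suc: "Y n \<omega> \<notin> D \<Longrightarrow> hitting_time D n \<omega> = hitting_time D (Suc n) \<omega>"
  unfolding hitting_time_def by (intro arg_cong[where f=Inf]) (metis le_antisym not_less_eq_eq Suc_leD)

lemma hitting_time_le_iff: "hitting_time D n \<omega> \<le> enat k \<longleftrightarrow> (\<exists>j\<in>{n..k}. Y j \<omega> \<in> D)"
proof -
  \<comment> \<open>The strict bound by \<open>Suc k\<close> makes \<open>Inf_less_iff\<close>
    applicable, which yields a witness.\<close>
  have "hitting_time D n \<omega> \<le> enat k \<longleftrightarrow> hitting_time D n \<omega> < enat (Suc k)"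
    by (cases "hitting_time D n \<omega>") auto
  also have "\<dots> \<longleftrightarrow> (\<exists>j\<in>{n..k}. Y j \<omega> \<in> D)"
    unfolding hitting_time_def Inf_less_iff
    by (auto simp: less_Suc_eq_le) (metis enat_ord_simps(2) less_Suc_eq_le)
  finally show ?thesis .
qed

lemma enat_stopping_time_hitting_time:
  assumes D: "Measurable.pred RE (\<lambda>x. x \<in> D)"
  shows "enat_stopping_time A (hitting_time D n)"
  unfolding enat_stopping_time_def hitting_time_le_iff
proof (intro allI pred_intros_finite)
  fix k j assume "j \<in> {n..k}"
  then have "j \<le> k" by simp
  have "Y j \<in> A k \<rightarrow>\<^sub>M RE"
    using measurable_from_subalg[OF _ adapted, of "A k" j] sets_F_mono[OF \<open>j \<le> k\<close>]
    by (auto simp: subalgebra_def)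
  then show "Measurable.pred (A k) (\<lambda>\<omega>. Y j \<omega> \<in> D)"
    using D by (rule measurable_compose)
qed simp

text \<open>Only an inequality, since \<open>hit_reward\<close> pays nothing for an entry after the
  \<open>m\<close> observations.\<close>

lemma hit_reward_le:
  "hit_reward D m n \<omega> \<le> ennreal (stopped_reward \<rho> g Y (hitting_time D n) \<omega>)"
proof (induction m arbitrary: n)
  case (Suc m)
  then show ?case
    using Suc[of "Suc n"] hitting_time_eq[of n \<omega> D] hitting_time_Suc[of n \<omega> D]
    by (auto simp: stopped_reward_def)
qed simp

lemma hit_value_le:
  assumes D: "Measurable.pred RE (\<lambda>x. x \<in> D)" and y: "y \<in> E"
  shows "hit_value D m y \<le> value_function A Y P \<rho> g y"
proof -
  have "hit_value D m y = (\<integral>\<^sup>+\<omega>\<in>space M. disc 0 (hit_value D m) \<omega> \<partial>P y)"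
    using nn_integral_disc_0[OF y] nn_set_integral_space[of "P y"] y by simp
  also have "\<dots> = (\<integral>\<^sup>+\<omega>\<in>space M. hit_reward D m 0 \<omega> \<partial>P y)"
    using sets.top[of "A 0"] by (intro hit_value_eq_hit_reward[OF D y]) simp
  also have "\<dots> \<le> expected_reward Y P \<rho> g (hitting_time D 0) y"
    unfolding expected_reward_def
    by (intro nn_integral_mono) (auto simp: indicator_def hit_reward_le)
  also have "\<dots> \<le> value_function A Y P \<rho> g y"
    unfolding value_function_def by (intro SUP_upper) (simp add: enat_stopping_time_hitting_time[OF D])
  finally show ?thesis .
qed

section \<open>Times of exceeding a level\<close>

lemma exceed_time_eq: "exceed_time Y c = hitting_time {c<..} 1"
  by (auto simp: exceed_time_def hitting_time_def Suc_le_eq)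

lemma pred_greaterThan: "Measurable.pred RE (\<lambda>x. x \<in> {c<..})"
  by (rule measurable_restrict_space1) measurable

text \<open>The outer \<open>dstep\<close> reflects that \<open>exceed_time\<close> is positive: the
  first step is taken wherever the process starts.\<close>

lemma dstep_hit_value_le:
  assumes y: "y \<in> E"
  shows "dstep (hit_value {c<..} m) y \<le> expected_reward Y P \<rho> g (exceed_time Y c) y"
proof -
  let ?D = "{c<..}"
  note D = pred_greaterThan[of c]
  have "dstep (hit_value ?D m) y = (\<integral>\<^sup>+\<omega>\<in>space M. disc 1 (hit_value ?D m) \<omega> \<partial>P y)"
    using dstep_eq_disc[OF y hit_value_measurable[OF D]] nn_set_integral_space[of "P y"] y by simp
  also have "\<dots> = (\<integral>\<^sup>+\<omega>\<in>space M. hit_reward ?D m 1 \<omega> \<partial>P y)"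
    using sets.top[of "A 1"] by (intro hit_value_eq_hit_reward[OF D y]) simp
  also have "\<dots> \<le> expected_reward Y P \<rho> g (exceed_time Y c) y"
    unfolding expected_reward_def exceed_time_eq
    by (intro nn_integral_mono) (auto simp: indicator_def hit_reward_le)
  finally show ?thesis .
qed

section \<open>The limit of value iteration as an upper bound for the value function\<close>

text \<open>By the Bellman equation \<open>snell_lim\<close> dominates \<open>g\<close> and
  \<open>dstep snell_lim\<close>. Along the process its discounted value is a nonnegative, possibly
  infinite supermartingale above the rewards, so stopping cannot beat its initial value.\<close>

lemma expected_reward_le_snell_lim:
  assumes y: "y \<in> E" and \<tau>: "enat_stopping_time A \<tau>"
  shows "expected_reward Y P \<rho> g \<tau> y \<le> snell_lim y"
proof -
  \<comment> \<open>\<open>R n\<close> is the reward already paid by time \<open>n\<close>, and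
    \<open>B n\<close> the event of not having stopped by then.\<close>
  define R where "R n \<omega> = (if \<tau> \<omega> \<le> enat n then ennreal (stopped_reward \<rho> g Y \<tau> \<omega>) else 0)" for n \<omega>
  define B where "B n = {\<omega> \<in> space M. \<not> \<tau> \<omega> \<le> enat n}" for n
  have B: "B n \<in> sets (A n)" for n
    using \<tau> sets.sets_Collect_neg[of "A n" "\<lambda>\<omega>. \<tau> \<omega> \<le> enat n"]
    by (simp add: enat_stopping_time_def B_def pred_def)
  note B_P [measurable] = sets_A_P[OF y B]
  note [simp] = \<open>y \<in> E\<close>
  \<comment> \<open>\<open>B n - B (Suc n)\<close> is the event \<open>\<tau> = Suc n\<close>, so a
    step adds exactly the reward paid at that time.\<close>
  have R_Suc: "R (Suc n) \<omega> = R n \<omega> + ennreal (\<rho> ^ Suc n * g (Y (Suc n) \<omega>)) * indicator (B n - B (Suc n)) \<omega>"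
    if "\<omega> \<in> space M" for n \<omega>
    using that by (cases "\<tau> \<omega>") (auto simp: R_def B_def indicator_def stopped_reward_def le_Suc_eq)
  have R_0: "R 0 \<omega> = ennreal (\<rho> ^ 0 * g (Y 0 \<omega>)) * indicator (space M - B 0) \<omega>"
    if "\<omega> \<in> space M" for \<omega>
    using that by (cases "\<tau> \<omega>") (auto simp: R_def B_def indicator_def stopped_reward_def)
  \<comment> \<open>\<open>\<tau>\<close> enters only through the events \<open>B n\<close>, so
    measurability is built up from the increments.\<close>
  have [measurable]: "R n \<in> borel_measurable (P y)" for n
  proof (induction n)
    case 0
    have "(\<lambda>\<omega>. ennreal (\<rho> ^ 0 * g (Y 0 \<omega>)) * indicator (space M - B 0) \<omega>) \<in> borel_measurable (P y)"
      using B_P[of 0] sets.top[of "P y"]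
      by (intro borel_measurable_times_ennreal g_Y_measurable borel_measurable_indicator) auto
    then show ?case
      by (subst measurable_cong[OF R_0]) auto
  next
    case (Suc n)
    have "(\<lambda>\<omega>. R n \<omega> + ennreal (\<rho> ^ Suc n * g (Y (Suc n) \<omega>)) * indicator (B n - B (Suc n)) \<omega>) \<in> borel_measurable (P y)"
      using B_P by (intro borel_measurable_add Suc borel_measurable_times_ennreal g_Y_measurable borel_measurable_indicator) auto
    then show ?case
      by (subst measurable_cong[OF R_Suc]) auto
  qed
  have g_le: "ennreal (\<rho> ^ n * g (Y n \<omega>)) \<le> disc n snell_lim \<omega>" if "\<omega> \<in> space M" for n \<omega>
    unfolding disc_g[symmetric] using snell_lim_eq[of "Y n \<omega>"] that
    by (auto simp: disc_def intro!: mult_left_mono)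
  \<comment> \<open>The invariant of optional stopping: the reward already paid plus the value still
    open on paths that have not stopped.\<close>
  have sum: "(\<integral>\<^sup>+\<omega>. R n \<omega> \<partial>P y) + (\<integral>\<^sup>+\<omega>\<in>B n. disc n snell_lim \<omega> \<partial>P y) \<le> snell_lim y" for n
  proof (induction n)
    case 0
    have "(\<integral>\<^sup>+\<omega>. R 0 \<omega> \<partial>P y) + (\<integral>\<^sup>+\<omega>\<in>B 0. disc 0 snell_lim \<omega> \<partial>P y)
        = (\<integral>\<^sup>+\<omega>. R 0 \<omega> + disc 0 snell_lim \<omega> * indicator (B 0) \<omega> \<partial>P y)"
      by (subst nn_integral_add) auto
    also have "\<dots> \<le> (\<integral>\<^sup>+\<omega>. disc 0 snell_lim \<omega> \<partial>P y)"
      using g_le[of _ 0] by (intro nn_integral_mono) (auto simp: R_0 indicator_def)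
    finally show ?case by (simp add: nn_integral_disc_0)
  next
    case (Suc n)
    have "(\<integral>\<^sup>+\<omega>. R (Suc n) \<omega> \<partial>P y) + (\<integral>\<^sup>+\<omega>\<in>B (Suc n). disc (Suc n) snell_lim \<omega> \<partial>P y)
        = (\<integral>\<^sup>+\<omega>. R (Suc n) \<omega> + disc (Suc n) snell_lim \<omega> * indicator (B (Suc n)) \<omega> \<partial>P y)"
      by (subst nn_integral_add) auto
    \<comment> \<open>A path stopping at \<open>Suc n\<close> exchanges \<open>snell_lim\<close> for
      the smaller reward \<open>g\<close>; on all other paths nothing changes.\<close>
    also have "\<dots> \<le> (\<integral>\<^sup>+\<omega>. R n \<omega> + disc (Suc n) snell_lim \<omega> * indicator (B n) \<omega> \<partial>P y)"
    proof (rule nn_integral_mono)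
      fix \<omega> assume "\<omega> \<in> space (P y)"
      then have \<omega>: "\<omega> \<in> space M" by simp
      have "B (Suc n) \<subseteq> B n" unfolding B_def by (auto simp: le_Suc_eq) (metis enat_ord_simps(1) lessI less_imp_le order_trans)
      then show "R (Suc n) \<omega> + disc (Suc n) snell_lim \<omega> * indicator (B (Suc n)) \<omega>
          \<le> R n \<omega> + disc (Suc n) snell_lim \<omega> * indicator (B n) \<omega>"
        unfolding R_Suc[OF \<omega>] using g_le[OF \<omega>, of "Suc n"] by (auto simp: indicator_def intro!: add_left_mono)
    qed
    also have "\<dots> = (\<integral>\<^sup>+\<omega>. R n \<omega> \<partial>P y) + (\<integral>\<^sup>+\<omega>\<in>B n. disc (Suc n) snell_lim \<omega> \<partial>P y)"
      by (subst nn_integral_add) auto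
    also have "(\<integral>\<^sup>+\<omega>\<in>B n. disc (Suc n) snell_lim \<omega> \<partial>P y) = (\<integral>\<^sup>+\<omega>\<in>B n. disc n (dstep snell_lim) \<omega> \<partial>P y)"
      by (rule markov_disc[OF y B snell_lim_measurable])
    also have "\<dots> \<le> (\<integral>\<^sup>+\<omega>\<in>B n. disc n snell_lim \<omega> \<partial>P y)"
      using snell_lim_eq by (intro nn_integral_mono mult_right_mono) (auto simp: disc_def intro!: mult_left_mono)
    finally show ?case using Suc by (auto intro: order_trans)
  qed
  \<comment> \<open>Where \<open>\<tau>\<close> is infinite both sides are 0: the stopped reward is
    0 there by definition, and no \<open>R n\<close> ever pays.\<close>
  have "expected_reward Y P \<rho> g \<tau> y = (\<integral>\<^sup>+\<omega>. (SUP n. R n \<omega>) \<partial>P y)"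
    unfolding expected_reward_def
  proof (rule nn_integral_cong)
    fix \<omega>
    show "ennreal (stopped_reward \<rho> g Y \<tau> \<omega>) = (SUP n. R n \<omega>)"
    proof (cases "\<tau> \<omega>")
      case (enat k)
      then show ?thesis
        by (intro antisym SUP_upper2[of k] SUP_least) (auto simp: R_def)
    qed (simp add: R_def stopped_reward_def)
  qed
  also have "\<dots> = (SUP n. \<integral>\<^sup>+\<omega>. R n \<omega> \<partial>P y)"
    by (intro nn_integral_monotone_convergence_SUP_AE AE_I2) (auto simp: R_Suc)
  also have "\<dots> \<le> snell_lim y"
    using sum by (intro SUP_least) (meson le_add1 order_trans add_increasing2 zero_le le_iff_add)
  finally show ?thesis .
qed

lemma value_function_le_snell_lim: "y \<in> E \<Longrightarrow> value_function A Y P \<rho> g y \<le> snell_lim y"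
  unfolding value_function_def by (intro SUP_least expected_reward_le_snell_lim) auto

section \<open>Unrolling the Bellman equation up to the contact set\<close>

lemma iterated_dstep_measurable [measurable]:
  "f \<in> borel_measurable RE \<Longrightarrow> (dstep ^^ m) f \<in> borel_measurable RE"
  by (induction m) auto

lemma iterated_dstep_eq_disc:
  assumes y: "y \<in> E" and f: "f \<in> borel_measurable RE"
  shows "(dstep ^^ m) f y = (\<integral>\<^sup>+\<omega>. disc m f \<omega> \<partial>P y)"
  using f
proof (induction m arbitrary: f)
  case 0
  then show ?case by (simp add: nn_integral_disc_0[OF y])
next
  case (Suc m)
  have "(dstep ^^ Suc m) f y = (\<integral>\<^sup>+\<omega>. disc m (dstep f) \<omega> \<partial>P y)"
    using Suc.IH[of "dstep f"] Suc.prems by (simp add: funpow_Suc_right del: funpow.simps)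
  also have "\<dots> = (\<integral>\<^sup>+\<omega>. disc (Suc m) f \<omega> \<partial>P y)"
    using markov_disc[OF y _ Suc.prems, of "space M" m] sets.top[of "A m"]
      nn_set_integral_space[of "P y"] y by simp
  finally show ?case .
qed

lemma pred_snell_contact [measurable]:
  "Measurable.pred RE (\<lambda>x. x \<in> {x \<in> E. snell_lim x = ennreal (g x)})"
proof -
  have "{x \<in> space RE. snell_lim x = ennreal (g x)} \<in> sets RE"
    by (intro borel_measurable_eq) measurable
  then show ?thesis by (simp add: pred_def)
qed

text \<open>Off the contact set the Bellman equation reads
  \<open>snell_lim = dstep snell_lim\<close>. Unrolling it \<open>m\<close> times, with a halt on
  entering \<open>D\<close>, leaves at most the remainder
  \<open>(dstep ^^ m) snell_lim\<close>.\<close>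

lemma snell_lim_le_hit_value:
  fixes D defines "D \<equiv> {x \<in> E. snell_lim x = ennreal (g x)}"
  assumes y: "y \<in> E"
  shows "snell_lim y \<le> hit_value D m y + (dstep ^^ m) snell_lim y"
  using y
proof (induction m arbitrary: y)
  case (Suc m)
  have D: "Measurable.pred RE (\<lambda>x. x \<in> D)"
    unfolding D_def by (rule pred_snell_contact)
  show ?case
  proof (cases "y \<in> D")
    case True
    then show ?thesis by (simp add: D_def)
  next
    case False
    then have "snell_lim y = dstep snell_lim y"
      using snell_lim_eq[OF Suc.prems] Suc.prems by (auto simp: D_def max_def split: if_splits)
    also have "\<dots> \<le> dstep (\<lambda>x. hit_value D m x + (dstep ^^ m) snell_lim x) y"
      by (rule dstep_mono[OF Suc.prems Suc.IH])
    also have "\<dots> = dstep (hit_value D m) y + dstep ((dstep ^^ m) snell_lim) y"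
      using D by (intro dstep_add Suc.prems) auto
    finally show ?thesis using False by simp
  qed
qed simp

end

section \<open>Identification of the value function and of the stopping set\<close>

locale vanishing_discounted_markov_process = discounted_markov_process +
  assumes integrable_sup: "\<And>y. y \<in> E \<Longrightarrow> (\<integral>\<^sup>+\<omega>. (SUP n. ennreal (\<rho> ^ n * g (Y n \<omega>))) \<partial>P y) < \<infinity>"
    and reward_tendsto_0: "\<And>y. y \<in> E \<Longrightarrow> AE \<omega> in P y. (\<lambda>n. \<rho> ^ n * g (Y n \<omega>)) \<longlonglongrightarrow> 0"
begin

text \<open>The remainder after \<open>m\<close> unrollings is at most the integral of
  \<open>tail_sup m\<close>, which tends to 0. Hence any bound common to all truncated rewards for
  entering the contact set also bounds \<open>snell_lim\<close>.\<close>

lemma snell_lim_le: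
  assumes y: "y \<in> E" and bound: "\<And>m. hit_value {x \<in> E. snell_lim x = ennreal (g x)} m y \<le> c"
  shows "snell_lim y \<le> c"
proof -
  have "(\<lambda>m. \<integral>\<^sup>+\<omega>. tail_sup m \<omega> \<partial>P y) \<longlonglongrightarrow> 0"
    by (rule tail_sup_integral_tendsto_0[OF y integrable_sup[OF y] reward_tendsto_0[OF y]])
  then have "(\<lambda>m. c + (\<integral>\<^sup>+\<omega>. tail_sup m \<omega> \<partial>P y)) \<longlonglongrightarrow> c + 0"
    by (intro tendsto_add tendsto_const)
  moreover have "snell_lim y \<le> c + (\<integral>\<^sup>+\<omega>. tail_sup m \<omega> \<partial>P y)" for m
    using snell_lim_le_hit_value[OF y, of m] bound[of m] snell_lim_le_tail_sup[OF y, of m]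
    by (auto simp: iterated_dstep_eq_disc[OF y] intro: order_trans add_mono)
  ultimately show ?thesis
    by (auto intro: LIMSEQ_le_const)
qed

text \<open>For the missing inequality \<open>snell_lim_le\<close> is applied with the value
  function as the bound, entering the contact set being an admissible way to stop.\<close>

lemma value_function_eq_snell_lim: "y \<in> E \<Longrightarrow> value_function A Y P \<rho> g y = snell_lim y"
  by (intro antisym value_function_le_snell_lim snell_lim_le hit_value_le pred_snell_contact)

lemma stopping_set_eq:
  "stopping_set E A Y P \<rho> g = {x \<in> E. snell_lim x = ennreal (g x)}"
  using value_function_eq_snell_lim by (auto simp: stopping_set_def)

lemma ladder_reward_le_of_stopping_set:
  assumes "z \<in> stopping_set E A Y P \<rho> g"
  shows "ladder_reward Y P \<rho> g z \<le> ennreal (g z)"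
proof -
  have "ladder_reward Y P \<rho> g z \<le> value_function A Y P \<rho> g z"
    unfolding ladder_reward_def value_function_def exceed_time_eq
    by (intro SUP_upper) (simp add: enat_stopping_time_hitting_time[OF pred_greaterThan])
  then show ?thesis
    using assms by (simp add: stopping_set_def)
qed

text \<open>By \<open>snell_lim_le\<close> it suffices to bound the truncated rewards for entering
  \<open>S\<close> from \<open>z\<close> by \<open>g z\<close>. If \<open>z \<notin> S\<close>, the
  up-set \<open>S\<close> lies strictly above \<open>z\<close>, and \<open>ladder\<close> controls
  every further rise of the level.\<close>

lemma stopping_set_of_ladder_reward_le:
  fixes S defines "S \<equiv> stopping_set E A Y P \<rho> g"
  assumes z: "z \<in> E"
    and upset: "\<And>x x'. x \<in> S \<Longrightarrow> x' \<in> E \<Longrightarrow> x \<le> x' \<Longrightarrow> x' \<in> S"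
    and ladder: "\<And>x. x \<in> E \<Longrightarrow> z \<le> x \<Longrightarrow> ladder_reward Y P \<rho> g x \<le> ennreal (g x)"
  shows "z \<in> S"
proof (rule ccontr)
  assume zS: "z \<notin> S"
  have S: "S = {x \<in> E. snell_lim x = ennreal (g x)}"
    unfolding S_def by (rule stopping_set_eq)
  text \<open>The comparison is one step at a time: at a point \<open>x > c\<close> outside \<open>S\<close> the level is raised
    to \<open>x\<close>, so that the next ladder time can be handled without the strong Markov property.\<close>
  have below: "hit_value S m x \<le> hit_value {c<..} m x"
    if "c \<in> E" "z \<le> c" "c \<notin> S" "x \<in> E" for m c x
    using that
  proof (induction m arbitrary: c x)
    case (Suc m)
    show ?case
    proof (cases "x \<le> c")
      case True
      \<comment> \<open>A point of \<open>S\<close> at or below \<open>c\<close> would force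
        \<open>c\<close> into \<open>S\<close>. Hence neither side stops here.\<close>
      then have "x \<notin> S" using upset Suc.prems by blast
      then show ?thesis
        using True Suc by (auto intro: dstep_mono)
    next
      case False
      \<comment> \<open>The right side stops above \<open>c\<close> and receives \<open>g x\<close>,
        as does the left side if \<open>x \<in> S\<close>. Otherwise \<open>x\<close> becomes the
        new level in the induction hypothesis.\<close>
      have "dstep (hit_value S m) x \<le> ennreal (g x)" if "x \<notin> S"
      proof -
        have "dstep (hit_value S m) x \<le> dstep (hit_value {x<..} m) x"
          using False Suc that by (intro dstep_mono) auto
        also have "\<dots> \<le> ladder_reward Y P \<rho> g x"
          unfolding ladder_reward_def by (rule dstep_hit_value_le) fact
        also have "\<dots> \<le> ennreal (g x)"
          using False Suc.prems by (intro ladder) auto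
        finally show ?thesis .
      qed
      then show ?thesis using False by simp
    qed
  qed simp
  have "hit_value S m z \<le> ennreal (g z)" for m
  proof (cases m)
    case (Suc k)
    \<comment> \<open>Since \<open>z \<notin> S\<close>, the process moves on from \<open>z\<close>,
      and \<open>below\<close> applies afterwards with level \<open>z\<close>.\<close>
    have "hit_value S m z = dstep (hit_value S k) z"
      using zS Suc by simp
    also have "\<dots> \<le> dstep (hit_value {z<..} k) z"
      using z zS by (intro dstep_mono below) auto
    also have "\<dots> \<le> ladder_reward Y P \<rho> g z"
      unfolding ladder_reward_def by (rule dstep_hit_value_le[OF z])
    also have "\<dots> \<le> ennreal (g z)"
      using z by (intro ladder) auto
    finally show ?thesis .
  qed simp
  then have "snell_lim z \<le> ennreal (g z)"
    unfolding S by (rule snell_lim_le[OF z])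
  moreover have "ennreal (g z) \<le> snell_lim z"
    using snell_lim_eq[OF z] by simp
  ultimately show False
    using zS z by (simp add: S)
qed

end

section \<open>Infimum and form of the stopping set\<close>

theorem theorem4p4:
  fixes E :: "real set"
    and M :: "'w measure"
    and A :: "nat \<Rightarrow> 'w measure"
    and Y :: "nat \<Rightarrow> 'w \<Rightarrow> real"
    and P :: "real \<Rightarrow> 'w measure"
    and \<rho> :: real
    and g :: "real \<Rightarrow> real"
    and b :: ereal
    and a :: real
  defines "S \<equiv> stopping_set E A Y P \<rho> g"
    and "\<phi> \<equiv> ladder_reward Y P \<rho> g"
  assumes "markov_process E M A Y P"
    and "0 < \<rho>" and "\<rho> \<le> 1"
    and "g \<in> borel_measurable borel" and "\<And>y. 0 \<le> g y"
    and "b < \<infinity>" and "{y. g y > 0} = {y. ereal y > b}"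
    and "\<And>y. y \<in> E \<Longrightarrow> (\<integral>\<^sup>+\<omega>. (SUP n. ennreal (\<rho> ^ n * g (Y n \<omega>))) \<partial>P y) < \<infinity>"
    and "\<And>y. y \<in> E \<Longrightarrow> AE \<omega> in P y. (\<lambda>n. \<rho> ^ n * g (Y n \<omega>)) \<longlonglongrightarrow> 0"
    and "S = {a..} \<inter> E \<or> S = {a<..} \<inter> E"
    and "ereal a = Inf (ereal ` S)" and "ereal a > b"
    and "\<And>z z'. z \<in> E \<Longrightarrow> z' \<in> E \<Longrightarrow> z' > z \<Longrightarrow> ereal z > b \<Longrightarrow>
           \<phi> z \<le> ennreal (g z) \<Longrightarrow> \<phi> z' \<le> ennreal (g z')"
  shows "ereal a = Inf (ereal ` {z \<in> E. ereal z > b \<and> \<phi> z \<le> ennreal (g z)}) \<and>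
    (a \<in> E \<longrightarrow>
       (\<phi> a \<le> ennreal (g a) \<longrightarrow> S = {a..} \<inter> E) \<and>
       (\<not> \<phi> a \<le> ennreal (g a) \<longrightarrow> S = {a<..} \<inter> E))"
proof -
  interpret vanishing_discounted_markov_process E M A Y P \<rho> g
    using assms(4)
    by (intro vanishing_discounted_markov_process.intro discounted_markov_process.intro
        discounted_markov_process_axioms.intro vanishing_discounted_markov_process_axioms.intro
        assms(3,6,7,10,11) less_imp_le)
  have upset: "x' \<in> S" if "x \<in> S" "x' \<in> E" "x \<le> x'" for x x'
    using assms(12) that by auto
  have above_b: "ereal z > b" if "z \<in> S" for z
  proof -
    have "ereal a \<le> ereal z"
      unfolding assms(13) using that by (intro Inf_lower imageI)
    with assms(14) show ?thesis by (rule less_le_trans)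
  qed
  have S_eq: "S = {z \<in> E. ereal z > b \<and> \<phi> z \<le> ennreal (g z)}"
  proof (intro set_eqI iffI)
    fix z assume "z \<in> S"
    then show "z \<in> {z \<in> E. ereal z > b \<and> \<phi> z \<le> ennreal (g z)}"
      using above_b ladder_reward_le_of_stopping_set[of z]
      by (auto simp: S_def \<phi>_def stopping_set_def)
  next
    fix z assume "z \<in> {z \<in> E. ereal z > b \<and> \<phi> z \<le> ennreal (g z)}"
    then have z: "z \<in> E" "ereal z > b" "\<phi> z \<le> ennreal (g z)"
      by auto
    \<comment> \<open>The assumed propagation reaches only points strictly above \<open>z\<close>,
      so \<open>x = z\<close> is treated apart.\<close>
    have "\<phi> x \<le> ennreal (g x)" if "x \<in> E" "z \<le> x" for x
    proof (cases "x = z")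
      case False
      then show ?thesis using assms(15)[OF z(1) that(1) _ z(2,3)] that(2) by simp
    qed (use z(3) in simp)
    then show "z \<in> S"
      using z(1) upset unfolding S_def \<phi>_def by (rule stopping_set_of_ladder_reward_le[rotated 2])
  qed
  have a_iff: "a \<in> S \<longleftrightarrow> \<phi> a \<le> ennreal (g a)" if "a \<in> E"
    unfolding S_eq using that assms(14) by simp
  \<comment> \<open>For \<open>a \<in> E\<close>, membership of \<open>a\<close> separates the two
    forms allowed for \<open>S\<close>, and \<open>a_iff\<close> decides it by
    \<open>\<phi> a\<close>.\<close>
  have closed: "S = {a..} \<inter> E" if "a \<in> S"
    using assms(12)
  proof
    assume "S = {a<..} \<inter> E"
    with that have "a \<in> {a<..} \<inter> E" by (rule back_subst)
    then show ?thesis by simp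
  qed
  have half_open: "S = {a<..} \<inter> E" if "a \<notin> S" "a \<in> E"
    using assms(12)
  proof
    assume "S = {a..} \<inter> E"
    moreover have "a \<in> {a..} \<inter> E" using that(2) by simp
    ultimately show ?thesis using that(1) by metis
  qed
  \<comment> \<open>By \<open>S_eq\<close> the infimum claimed is the one assumed for
    \<open>S\<close>.\<close>
  show ?thesis
    using assms(13) a_iff closed half_open unfolding S_eq[symmetric] by metis
qed

end
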